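(* Let $\Theta_n\uparrow\Theta$ and $\theta_0\in\Theta$. Assume that $\log N_]^{n\otimes}(\varepsilon_n,\Theta_n,d_n)\le n\varepsilon_n^2$ for some sequence $\varepsilon_n\to0$ with $n\varepsilon_n^2\to\infty$. Let $\Pi_n$ be the uniform measure on the renormalized collection of upper product brackets, that is, with $N=N_]^{n\otimes}(\varepsilon_n,\Theta_n,d_n)$ and $(u_{j,i}:j=1,\dots,N,\ i=1,\dots,n)$ a componentwise Hellinger upper bracketing for $\Theta_n$ at level $\varepsilon_n$, the measure assigning mass $N^{-1}$ to each of the joint densities $p_j^{(n)}=\bigotimes_{i=1}^n\bigl(u_{j,i}/\int u_{j,i}\,d\mu_i\bigr)$, $j=1,\dots,N$. Then for all sufficiently large $M$, $$P_{\theta_0}^{(n)}\Pi_n\bigl(p^{(n)}:d_n^2(p_{\theta_0}^{(n)},p^{(n)})\ge M\varepsilon_n^2\,\big|\,X_1,X_2,\dots,X_n\bigr)\to0.$$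
   Context: For each $n$, $P_\theta^{(n)}$, $\theta\in\Theta$, is an $n$-fold product measure with density $p_\theta^{(n)}(x_1,\dots,x_n)=\prod_{i=1}^np_{\theta,i}(x_i)$ relative to a product dominating measure $\bigotimes_{i=1}^n\mu_i$; $X_1,\dots,X_n$ are the independent observations. $h(f,g)=(\int(f^{1/2}-g^{1/2})^2d\mu)^{1/2}$ is the Hellinger distance between nonnegative integrable functions. For product densities $p=\bigotimes_ip_i$ and $q=\bigotimes_iq_i$, $d_n^2(p,q)=\frac1n\sum_{i=1}^nh^2(p_i,q_i)$. For given $n$ and $\varepsilon>0$, a componentwise Hellinger upper bracketing of a set $\Theta'\subset\Theta$ at level $\varepsilon$ is a family of integrable nonnegative functions $u_{j,i}$, $j=1,\dots,N$, $i=1,\dots,n$, such that for any $\theta\in\Theta'$ there exists some $j$ with $p_{\theta,i}\le u_{j,i}$ for all $i=1,\dots,n$ and $\sum_{i=1}^nh^2(p_{\theta,i},u_{j,i})\le n\varepsilon^2$; the componentwise Hellinger upper bracketing number $N_]^{n\otimes}(\varepsilon,\Theta',d_n)$ is the smallest such $N$. The posterior is given by Bayes' formula for the prior $\Pi_n$, which is supported on the finite set $\{p_1^{(n)},\dots,p_N^{(n)}\}$: $\Pi_n(B\mid X_1,\dots,X_n)=\sum_{j:p_j^{(n)}\in B}p_j^{(n)}(X_1,\dots,X_n)/\sum_jp_j^{(n)}(X_1,\dots,X_n)$. $Pf=\int f\,dP$. *)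

theory Defs
  imports "HOL-Probability.Probability"
begin

definition prob_density :: "'x measure \<Rightarrow> ('x \<Rightarrow> real) \<Rightarrow> bool" where
  "prob_density \<mu> f \<longleftrightarrow>
     integrable \<mu> f \<and> (\<forall>x\<in>space \<mu>. 0 \<le> f x) \<and> (\<integral>x. f x \<partial>\<mu>) = 1"

text \<open>Used for nonnegative integrable functions only; the integral is then finite.\<close>

definition hellinger :: "'x measure \<Rightarrow> ('x \<Rightarrow> real) \<Rightarrow> ('x \<Rightarrow> real) \<Rightarrow> real" where
  "hellinger \<mu> f g = sqrt (\<integral>x. (sqrt (f x) - sqrt (g x))\<^sup>2 \<partial>\<mu>)"

text \<open>A product density on the coordinates \<open>1, \<dots>, n\<close> is represented by its family of
  factors \<open>f :: nat \<Rightarrow> 'x \<Rightarrow> real\<close>; only the factors with index in \<open>{1..n}\<close> matter.\<close>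

definition joint_density :: "nat \<Rightarrow> (nat \<Rightarrow> 'x \<Rightarrow> real) \<Rightarrow> (nat \<Rightarrow> 'x) \<Rightarrow> real" where
  "joint_density n f x = (\<Prod>i\<in>{1..n}. f i (x i))"

definition joint_distribution ::
    "nat \<Rightarrow> (nat \<Rightarrow> 'x measure) \<Rightarrow> (nat \<Rightarrow> 'x \<Rightarrow> real) \<Rightarrow> (nat \<Rightarrow> 'x) measure" where
  "joint_distribution n \<mu> f = density (PiM {1..n} \<mu>) (\<lambda>x. ennreal (joint_density n f x))"

definition avg_hellinger ::
    "nat \<Rightarrow> (nat \<Rightarrow> 'x measure) \<Rightarrow> (nat \<Rightarrow> 'x \<Rightarrow> real) \<Rightarrow> (nat \<Rightarrow> 'x \<Rightarrow> real) \<Rightarrow> real" where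
  "avg_hellinger n \<mu> f g = sqrt (1 / real n * (\<Sum>i\<in>{1..n}. (hellinger (\<mu> i) (f i) (g i))\<^sup>2))"

definition upper_bracketing ::
    "nat \<Rightarrow> (nat \<Rightarrow> 'x measure) \<Rightarrow> ('t \<Rightarrow> nat \<Rightarrow> 'x \<Rightarrow> real) \<Rightarrow> real \<Rightarrow> 't set
      \<Rightarrow> nat \<Rightarrow> (nat \<Rightarrow> nat \<Rightarrow> 'x \<Rightarrow> real) \<Rightarrow> bool" where
  "upper_bracketing n \<mu> p \<epsilon> T N u \<longleftrightarrow>
     (\<forall>j\<in>{1..N}. \<forall>i\<in>{1..n}.
        integrable (\<mu> i) (u j i) \<and> (\<forall>x\<in>space (\<mu> i). 0 \<le> u j i x)) \<and>
     (\<forall>\<theta>\<in>T. \<exists>j\<in>{1..N}.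
        (\<forall>i\<in>{1..n}. \<forall>x\<in>space (\<mu> i). p \<theta> i x \<le> u j i x) \<and>
        (\<Sum>i\<in>{1..n}. (hellinger (\<mu> i) (p \<theta> i) (u j i))\<^sup>2) \<le> real n * \<epsilon>\<^sup>2)"

text \<open>The value is \<open>\<infinity>\<close> if there is no finite bracketing.\<close>

definition upper_bracketing_number ::
    "nat \<Rightarrow> (nat \<Rightarrow> 'x measure) \<Rightarrow> ('t \<Rightarrow> nat \<Rightarrow> 'x \<Rightarrow> real) \<Rightarrow> real \<Rightarrow> 't set \<Rightarrow> enat" where
  "upper_bracketing_number n \<mu> p \<epsilon> T = Inf {enat N | N. \<exists>u. upper_bracketing n \<mu> p \<epsilon> T N u}"

definition renormalize ::
    "(nat \<Rightarrow> 'x measure) \<Rightarrow> (nat \<Rightarrow> 'x \<Rightarrow> real) \<Rightarrow> nat \<Rightarrow> 'x \<Rightarrow> real" where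
  "renormalize \<mu> f = (\<lambda>i x. f i x / (\<integral>y. f i y \<partial>\<mu> i))"

text \<open>Densities occurring several times among \<open>q 1, \<dots>, q N\<close> get mass \<open>1 / N\<close> for each occurrence.
  Meaningful for \<open>N \<ge> 1\<close> only.\<close>

definition uniform_prior :: "nat \<Rightarrow> (nat \<Rightarrow> nat \<Rightarrow> 'x \<Rightarrow> real) \<Rightarrow> (nat \<Rightarrow> 'x \<Rightarrow> real) pmf" where
  "uniform_prior N q = map_pmf q (pmf_of_set {1..N})"

text \<open>Bayes' formula; the value is \<open>0\<close> at observations where the denominator vanishes.\<close>

definition posterior ::
    "nat \<Rightarrow> (nat \<Rightarrow> 'x \<Rightarrow> real) pmf \<Rightarrow> (nat \<Rightarrow> 'x \<Rightarrow> real) set \<Rightarrow> (nat \<Rightarrow> 'x) \<Rightarrow> real" where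
  "posterior n \<pi> B x =
     (\<integral>f. indicator B f * joint_density n f x \<partial>measure_pmf \<pi>) /
     (\<integral>f. joint_density n f x \<partial>measure_pmf \<pi>)"

lemma posterior_uniform_prior:
  assumes "N \<ge> 1"
  shows "posterior n (uniform_prior N q) B x =
    (\<Sum>j | j \<in> {1..N} \<and> q j \<in> B. joint_density n (q j) x) /
    (\<Sum>j\<in>{1..N}. joint_density n (q j) x)"
proof -
  define I where "I = {1..N}"
  have I: "I \<noteq> {}" "finite I" using assms by (auto simp: I_def)
  have "(\<Sum>j\<in>I. indicator B (q j) * joint_density n (q j) x) =
      (\<Sum>j | j \<in> I \<and> q j \<in> B. joint_density n (q j) x)"
    using I(2) by (intro sum.mono_neutral_cong_right) (auto simp: indicator_def)
  then show ?thesis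
    unfolding I_def[symmetric] posterior_def uniform_prior_def
    using I by (simp add: integral_pmf_of_set card_gt_0_iff)
qed

end

theory Submission imports Defs begin

text \<open>Let \<open>p\<^sub>0\<close> be the true joint density and \<open>q\<^sup>*\<close> the renormalized bracket
  above it. A single term \<open>q\<^sub>j\<close> contributes at most \<open>min 1 (q\<^sub>j / q\<^sup>*)\<close> to the posterior, and for every
  \<open>L > 0\<close> this is at most \<open>L sqrt (q\<^sub>j / p\<^sub>0) + (p\<^sub>0 / q\<^sup>*) / L\<^sup>2\<close>. The first summand
  has expectation \<open>L\<close> times the Hellinger affinity, which is exponentially small if \<open>q\<^sub>j\<close> is far from
  \<open>p\<^sub>0\<close>. The second is controlled by a chi-square type bound: because \<open>p\<^sub>0\<close> lies below the bracket,
  \<open>\<integral> p\<^sub>0\<^sup>2 / q\<^sup>*\<close> is at most \<open>1 + 16 h\<^sup>2\<close> in every coordinate, even though the mass of the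
  bracket may exceed \<open>1\<close> by a term of order \<open>h\<close>. With \<open>L = exp (M n \<epsilon>\<^sup>2 / 4)\<close> both are small
  enough to sum over the at most \<open>exp (n \<epsilon>\<^sup>2)\<close> brackets.\<close>

section \<open>Hellinger distance and affinity in one coordinate\<close>

lemma hellinger_power2: "(hellinger \<mu> f g)\<^sup>2 = (\<integral>x. (sqrt (f x) - sqrt (g x))\<^sup>2 \<partial>\<mu>)"
  unfolding hellinger_def by (simp add: integral_nonneg_AE)

lemma sqrt_prod:
  fixes f :: "'i \<Rightarrow> real"
  shows "sqrt (\<Prod>i\<in>I. f i) = (\<Prod>i\<in>I. sqrt (f i))"
  by (induction I rule: infinite_finite_induct) (auto simp: real_sqrt_mult)

lemma integrable_sqrt_mult:
  fixes f g :: "'x \<Rightarrow> real"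
  assumes "integrable \<mu> f" "\<forall>x\<in>space \<mu>. 0 \<le> f x" "integrable \<mu> g" "\<forall>x\<in>space \<mu>. 0 \<le> g x"
  shows "integrable \<mu> (\<lambda>x. sqrt (f x * g x))"
proof (rule Bochner_Integration.integrable_bound)
  show "integrable \<mu> (\<lambda>x. f x + g x)" using assms by simp
  show "(\<lambda>x. sqrt (f x * g x)) \<in> borel_measurable \<mu>"
    using assms(1,3)[THEN borel_measurable_integrable] by measurable
  have "sqrt (f x * g x) \<le> f x + g x" if "x \<in> space \<mu>" for x
    using arith_geo_mean_sqrt[of "f x" "g x"] assms(2,4) that by (fastforce simp: field_simps)
  then show "AE x in \<mu>. norm (sqrt (f x * g x)) \<le> norm (f x + g x)"
    using assms(2,4) by (intro AE_I2) simp
qed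

lemma
  fixes f g :: "'x \<Rightarrow> real"
  assumes "integrable \<mu> f" "\<forall>x\<in>space \<mu>. 0 \<le> f x" "integrable \<mu> g" "\<forall>x\<in>space \<mu>. 0 \<le> g x"
  shows integrable_hellinger: "integrable \<mu> (\<lambda>x. (sqrt (f x) - sqrt (g x))\<^sup>2)"
    and hellinger_power2_eq:
      "(hellinger \<mu> f g)\<^sup>2 = (\<integral>x. f x \<partial>\<mu>) + (\<integral>x. g x \<partial>\<mu>) - 2 * (\<integral>x. sqrt (f x * g x) \<partial>\<mu>)"
proof -
  have eq: "(sqrt (f x) - sqrt (g x))\<^sup>2 = f x + g x - 2 * sqrt (f x * g x)" if "x \<in> space \<mu>" for x
    using that assms(2,4) by (simp add: power2_diff real_sqrt_mult)
  note int = assms(1,3) integrable_sqrt_mult[OF assms]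
  show "integrable \<mu> (\<lambda>x. (sqrt (f x) - sqrt (g x))\<^sup>2)"
    using int by (subst Bochner_Integration.integrable_cong[OF refl eq]) auto
  show "(hellinger \<mu> f g)\<^sup>2 = (\<integral>x. f x \<partial>\<mu>) + (\<integral>x. g x \<partial>\<mu>) - 2 * (\<integral>x. sqrt (f x * g x) \<partial>\<mu>)"
    unfolding hellinger_power2
    using int by (subst Bochner_Integration.integral_cong[OF refl eq]) auto
qed

text \<open>Expanding the square gives twice the affinity as the sum of the two masses minus the
  squared distance; then \<open>1 + x \<le> exp x\<close>. The exponential form lets the bounds
  multiply over the coordinates. Mass at most 1 suffices, since the expansion only needs an upper
  bound on the masses.\<close>

lemma affinity_le_exp_hellinger:
  fixes f g :: "'x \<Rightarrow> real"
  assumes "integrable \<mu> f" "\<forall>x\<in>space \<mu>. 0 \<le> f x" "integrable \<mu> g" "\<forall>x\<in>space \<mu>. 0 \<le> g x"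
    and "(\<integral>x. f x \<partial>\<mu>) \<le> 1" "(\<integral>x. g x \<partial>\<mu>) \<le> 1"
  shows "(\<integral>x. sqrt (f x * g x) \<partial>\<mu>) \<le> exp (- (hellinger \<mu> f g)\<^sup>2 / 2)"
proof -
  have "(\<integral>x. sqrt (f x * g x) \<partial>\<mu>) \<le> 1 + - (hellinger \<mu> f g)\<^sup>2 / 2"
    using hellinger_power2_eq[OF assms(1-4)] assms(5,6) by linarith
  also have "\<dots> \<le> exp (- (hellinger \<mu> f g)\<^sup>2 / 2)" by (rule exp_ge_add_one_self)
  finally show ?thesis .
qed

section \<open>Chi-square bound for a renormalized upper bracket\<close>

text \<open>With \<open>c\<close> the mass of \<open>u\<close>, the product of the two integrals is
  the integral of \<open>p\<close> squared over \<open>u / c\<close>, that is, 1 plus the chi-square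
  divergence of \<open>p\<close> from the renormalized bracket. Since \<open>c - 1\<close> may be of
  first order in the Hellinger distance, the two factors must be estimated jointly to get a bound of
  second order.\<close>

lemma
  fixes p u :: "'x \<Rightarrow> real"
  assumes p: "prob_density \<mu> p" and u: "integrable \<mu> u"
    and le: "\<forall>x\<in>space \<mu>. p x \<le> u x"
  shows integrable_square_div_bracket: "integrable \<mu> (\<lambda>x. (p x)\<^sup>2 / u x)"
    and bracket_chi_square:
      "(\<integral>x. u x \<partial>\<mu>) * (\<integral>x. (p x)\<^sup>2 / u x \<partial>\<mu>) \<le> exp (16 * (hellinger \<mu> p u)\<^sup>2)"
proof -
  define c where "c = (\<integral>x. u x \<partial>\<mu>)"
  define m where "m = (\<integral>x. (p x)\<^sup>2 / u x \<partial>\<mu>)"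
  define H where "H = (hellinger \<mu> p u)\<^sup>2"
  have pi: "integrable \<mu> p" and p0: "\<forall>x\<in>space \<mu>. 0 \<le> p x" and p1: "(\<integral>x. p x \<partial>\<mu>) = 1"
    using p by (auto simp: prob_density_def)
  have u0: "\<forall>x\<in>space \<mu>. 0 \<le> u x" using le p0 by force
  note hi = integrable_hellinger[OF pi p0 u u0]
  have mp: "(p x)\<^sup>2 / u x \<le> p x" if "x \<in> space \<mu>" for x
  proof (cases "u x = 0")
    case False
    then have "u x > 0" using u0 that by force
    then show ?thesis using le p0 that by (simp add: divide_le_eq power2_eq_square mult_left_mono)
  qed (use p0 that in auto)
  have m0: "0 \<le> (p x)\<^sup>2 / u x" if "x \<in> space \<mu>" for x using u0 that by simp
  show mi: "integrable \<mu> (\<lambda>x. (p x)\<^sup>2 / u x)"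
  proof (rule Bochner_Integration.integrable_bound[OF pi])
    show "(\<lambda>x. (p x)\<^sup>2 / u x) \<in> borel_measurable \<mu>"
      using pi[THEN borel_measurable_integrable] u[THEN borel_measurable_integrable] by measurable
    show "AE x in \<mu>. norm ((p x)\<^sup>2 / u x) \<le> norm (p x)"
      using mp m0 p0 by (intro AE_I2) (simp only: real_norm_def abs_of_nonneg)
  qed
  have "m \<le> (\<integral>x. p x \<partial>\<mu>)" unfolding m_def by (intro integral_mono mi pi mp)
  then have m1: "m \<le> 1" by (simp add: p1)
  have c1: "1 \<le> c" unfolding c_def p1[symmetric] using le by (intro integral_mono pi u) auto
  have H0: "0 \<le> H" by (simp add: H_def)
  have Hi: "(\<integral>x. (sqrt (p x) - sqrt (u x))\<^sup>2 \<partial>\<mu>) = H" by (simp add: H_def hellinger_power2)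
  \<comment> \<open>A crude bound on the mass of the bracket: integrated, it gives
    \<open>c \<le> 2 + 2 * H\<close>.\<close>
  have "u x \<le> 2 * p x + 2 * (sqrt (p x) - sqrt (u x))\<^sup>2" if "x \<in> space \<mu>" for x
  proof -
    have "0 \<le> (2 * sqrt (p x) - sqrt (u x))\<^sup>2" by simp
    then show ?thesis using that p0 u0 by (simp add: power2_diff power_mult_distrib)
  qed
  then have "c \<le> (\<integral>x. 2 * p x + 2 * (sqrt (p x) - sqrt (u x))\<^sup>2 \<partial>\<mu>)"
    unfolding c_def using pi hi u by (intro integral_mono) auto
  then have c2: "c \<le> 2 + 2 * H" using pi hi by (simp add: p1 Hi)
  \<comment> \<open>Where \<open>u x\<close> is nonzero, the left side is \<open>(u x - p x)\<close>
    squared over \<open>u x\<close>. Factoring the difference of squares and using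
    \<open>a + b \<le> 2 * b\<close>, which is where domination by the bracket enters, yields the
    constant 4. Where \<open>u x = 0\<close>, also \<open>p x = 0\<close> and both sides
    vanish.\<close>
  have "u x - 2 * p x + (p x)\<^sup>2 / u x \<le> 4 * (sqrt (p x) - sqrt (u x))\<^sup>2" if x: "x \<in> space \<mu>" for x
  proof (cases "u x = 0")
    case True
    then show ?thesis using le p0 x by force
  next
    case False
    define a b where "a = sqrt (p x)" and "b = sqrt (u x)"
    have ab: "0 \<le> a" "a \<le> b" "0 < b" "p x = a\<^sup>2" "u x = b\<^sup>2"
      using le p0 u0 x False by (auto simp: a_def b_def less_le)
    have "(b\<^sup>2 - a\<^sup>2)\<^sup>2 = (b + a)\<^sup>2 * (a - b)\<^sup>2" by algebra
    also have "\<dots> \<le> (2 * b)\<^sup>2 * (a - b)\<^sup>2"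
      using ab by (intro mult_right_mono power_mono) auto
    finally have "(b\<^sup>2 - a\<^sup>2)\<^sup>2 / b\<^sup>2 \<le> 4 * (a - b)\<^sup>2" using ab
      by (simp add: divide_le_eq power_mult_distrib mult_ac)
    moreover have "b\<^sup>2 - 2 * a\<^sup>2 + (a\<^sup>2)\<^sup>2 / b\<^sup>2 = (b\<^sup>2 - a\<^sup>2)\<^sup>2 / b\<^sup>2"
      using ab by (simp add: field_simps power2_eq_square)
    ultimately show ?thesis unfolding ab(4,5) using ab by simp
  qed
  then have "(\<integral>x. u x - 2 * p x + (p x)\<^sup>2 / u x \<partial>\<mu>) \<le> (\<integral>x. 4 * (sqrt (p x) - sqrt (u x))\<^sup>2 \<partial>\<mu>)"
    using pi hi u mi by (intro integral_mono) auto
  then have chi: "c - 2 + m \<le> 4 * H"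
    using pi hi u mi by (simp add: p1 Hi c_def m_def)
  \<comment> \<open>For \<open>H \<le> 1\<close> the mass \<open>c\<close> is at most 4, which turns
    \<open>4 * H\<close> into \<open>16 * H\<close>. For larger \<open>H\<close> the trivial bound
    \<open>c * m \<le> c \<le> 2 + 2 * H\<close> is already good enough.\<close>
  have "c * m \<le> 1 + 16 * H"
  proof (cases "H \<le> 1")
    case True
    \<comment> \<open>the terms of first order in \<open>c - 1\<close> cancel here\<close>
    have "c * m = 1 + c * (c - 2 + m) - (c - 1)\<^sup>2" by algebra
    also have "\<dots> \<le> 1 + c * (4 * H)" using mult_left_mono[OF chi, of c] c1 by (smt (verit) zero_le_power2)
    also have "\<dots> \<le> 1 + 4 * (4 * H)" using True c2 H0 by (intro add_left_mono mult_right_mono) auto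
    finally show ?thesis by simp
  next
    case False
    have "c * m \<le> c * 1" using m1 c1 by (intro mult_left_mono) auto
    then show ?thesis using False c2 by linarith
  qed
  also have "\<dots> \<le> exp (16 * H)" by (rule exp_ge_add_one_self)
  finally show "(\<integral>x. u x \<partial>\<mu>) * (\<integral>x. (p x)\<^sup>2 / u x \<partial>\<mu>) \<le> exp (16 * (hellinger \<mu> p u)\<^sup>2)"
    by (simp add: c_def m_def H_def)
qed

section \<open>Integrals of product functions over product spaces\<close>

lemma nn_integral_PiM_prod:
  assumes "finite I" "\<And>i. i \<in> I \<Longrightarrow> sigma_finite_measure (\<mu> i)"
    and "\<And>i. i \<in> I \<Longrightarrow> f i \<in> borel_measurable (\<mu> i)"
  shows "(\<integral>\<^sup>+x. (\<Prod>i\<in>I. f i (x i)) \<partial>PiM I \<mu>) = (\<Prod>i\<in>I. \<integral>\<^sup>+y. f i y \<partial>\<mu> i)"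
proof -
  \<comment> \<open>The locale \<open>product_sigma_finite\<close> demands sigma-finiteness at every
    index, so the family is filled up outside \<open>I\<close> by a one-point space; the product
    over \<open>I\<close> does not see this.\<close>
  define \<nu> where "\<nu> = (\<lambda>i. if i \<in> I then \<mu> i else count_space {undefined})"
  interpret product_sigma_finite \<nu>
    by (rule product_sigma_finite.intro)
      (simp add: \<nu>_def assms(2) sigma_finite_measure_count_space_finite)
  have "PiM I \<mu> = PiM I \<nu>" by (intro PiM_cong) (auto simp: \<nu>_def)
  then show ?thesis
    using assms product_nn_integral_prod[of I f] by (simp add: \<nu>_def)
qed

text \<open>Fubini reduces the integral to one factor per coordinate, and exponential bounds on the
  factors add up in the exponent. Both the affinity and the chi-square bound pass to the joint
  densities this way.\<close>

lemma nn_integral_PiM_prod_real_le: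
  fixes f :: "'i \<Rightarrow> 'x \<Rightarrow> real"
  assumes "finite I" "\<And>i. i \<in> I \<Longrightarrow> sigma_finite_measure (\<mu> i)"
    and int: "\<And>i. i \<in> I \<Longrightarrow> integrable (\<mu> i) (f i)"
    and nonneg: "\<And>i. i \<in> I \<Longrightarrow> \<forall>y\<in>space (\<mu> i). 0 \<le> f i y"
    and le: "\<And>i. i \<in> I \<Longrightarrow> (\<integral>y. f i y \<partial>\<mu> i) \<le> exp (b i)"
  shows "(\<integral>\<^sup>+x. ennreal (\<Prod>i\<in>I. f i (x i)) \<partial>PiM I \<mu>) \<le> ennreal (exp (\<Sum>i\<in>I. b i))"
proof -
  have "(\<integral>\<^sup>+x. ennreal (\<Prod>i\<in>I. f i (x i)) \<partial>PiM I \<mu>)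
      = (\<integral>\<^sup>+x. (\<Prod>i\<in>I. ennreal (f i (x i))) \<partial>PiM I \<mu>)"
    using nonneg by (intro nn_integral_cong prod_ennreal[symmetric]) (auto simp: space_PiM PiE_iff)
  also have "\<dots> = (\<Prod>i\<in>I. \<integral>\<^sup>+y. ennreal (f i y) \<partial>\<mu> i)"
    using assms(1,2) int by (intro nn_integral_PiM_prod) auto
  also have "\<dots> = (\<Prod>i\<in>I. ennreal (\<integral>y. f i y \<partial>\<mu> i))"
    using int nonneg by (intro prod.cong refl nn_integral_eq_integral) auto
  also have "\<dots> = ennreal (\<Prod>i\<in>I. \<integral>y. f i y \<partial>\<mu> i)"
    using nonneg by (intro prod_ennreal Bochner_Integration.integral_nonneg) auto
  also have "\<dots> \<le> ennreal (\<Prod>i\<in>I. exp (b i))"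
    using nonneg le by (intro ennreal_leI prod_mono conjI Bochner_Integration.integral_nonneg) auto
  finally show ?thesis using assms(1) by (simp add: exp_sum)
qed

lemma measurable_joint_density:
  assumes "\<And>i. i \<in> {1..n} \<Longrightarrow> f i \<in> borel_measurable (\<mu> i)"
  shows "joint_density n f \<in> borel_measurable (PiM {1..n} \<mu>)"
  unfolding joint_density_def
proof (intro borel_measurable_prod)
  fix i assume i: "i \<in> {1..n}"
  show "(\<lambda>x. f i (x i)) \<in> borel_measurable (PiM {1..n} \<mu>)"
    by (rule measurable_compose[OF measurable_component_singleton[where M = \<mu>, OF i] assms[OF i]])
qed

section \<open>Expected posterior mass for a fixed number of observations\<close>

text \<open>The ratio \<open>p / r\<close> is truncated at the square of \<open>L\<close>. Below
  that level, \<open>q / r\<close> is at most the square of \<open>a = L * sqrt (q / p)\<close>, and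
  a squared number capped at 1 is at most the number itself. Above it, the second summand alone
  exceeds 1.\<close>

lemma min_one_ratio_le:
  fixes p q r L :: real
  assumes "p > 0" "r > 0" "q \<ge> 0" "L > 0"
  shows "min 1 (q / r) \<le> L * sqrt (q / p) + p / r / L\<^sup>2"
proof (cases "p / r \<le> L\<^sup>2")
  case True
  define a where "a = L * sqrt (q / p)"
  have a: "a \<ge> 0" "a\<^sup>2 = L\<^sup>2 * (q / p)" using assms by (auto simp: a_def power_mult_distrib)
  have "q / r = p / r * (q / p)" using assms by simp
  also have "\<dots> \<le> a\<^sup>2" unfolding a using True assms by (intro mult_right_mono) auto
  finally have "q / r \<le> a\<^sup>2" .
  moreover have "min 1 (a\<^sup>2) \<le> a"
    using a(1) power_decreasing[of 1 2 a] by (cases "a \<le> 1") auto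
  ultimately have "min 1 (q / r) \<le> a" by linarith
  moreover have "0 \<le> p / r / L\<^sup>2" using assms by simp
  ultimately show ?thesis unfolding a_def by linarith
next
  case False
  then have "1 \<le> p / r / L\<^sup>2" using assms by (subst le_divide_eq_1_pos) auto
  moreover have "0 \<le> L * sqrt (q / p)" using assms by simp
  ultimately show ?thesis by linarith
qed

text \<open>A non-integrable function has Bochner integral 0, so the bound persists in that case.
  This allows the posterior to be treated without first proving it measurable.\<close>

lemma integral_le_of_nn_integral_le:
  fixes f :: "'x \<Rightarrow> real"
  assumes "AE x in M. 0 \<le> f x" "(\<integral>\<^sup>+x. ennreal (f x) \<partial>M) \<le> ennreal B" "0 \<le> B"
  shows "(\<integral>x. f x \<partial>M) \<le> B"
  using assms by (cases "integrable M f")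
    (simp_all add: nn_integral_eq_integral ennreal_le_iff not_integrable_integral_eq)

text \<open>The mass is 1 except when the bracket has integral 0: division by zero then makes the
  renormalized function vanish, which is why only an upper bound is claimed.\<close>

lemma subprob_density_renormalize:
  assumes "integrable (\<mu> i) (f i)" "\<forall>x\<in>space (\<mu> i). 0 \<le> f i x"
  shows "integrable (\<mu> i) (renormalize \<mu> f i)" "\<forall>x\<in>space (\<mu> i). 0 \<le> renormalize \<mu> f i x"
    "(\<integral>x. renormalize \<mu> f i x \<partial>\<mu> i) \<le> 1"
proof -
  have "0 \<le> (\<integral>x. f i x \<partial>\<mu> i)" using assms(2) by (intro Bochner_Integration.integral_nonneg) auto
  then show "\<forall>x\<in>space (\<mu> i). 0 \<le> renormalize \<mu> f i x"
    using assms(2) by (simp add: renormalize_def)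
qed (use assms(1) in \<open>auto simp: renormalize_def\<close>)

lemma joint_density_nonneg:
  assumes "\<And>i. i \<in> {1..n} \<Longrightarrow> \<forall>y\<in>space (\<mu> i). 0 \<le> f i y" "x \<in> space (PiM {1..n} \<mu>)"
  shows "0 \<le> joint_density n f x"
  unfolding joint_density_def using assms by (intro prod_nonneg) (auto simp: space_PiM PiE_iff)

lemma avg_hellinger_power2:
  "n \<ge> 1 \<Longrightarrow> real n * (avg_hellinger n \<mu> f g)\<^sup>2 = (\<Sum>i\<in>{1..n}. (hellinger (\<mu> i) (f i) (g i))\<^sup>2)"
  by (simp add: avg_hellinger_def sum_nonneg)

text \<open>Each far bracket contributes one affinity term and one chi-square term, and there are at
  most \<open>N\<close> of them. The truncation level \<open>L\<close> stays free so that the two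
  terms can be balanced afterwards.\<close>

lemma expected_posterior_le:
  fixes \<mu> :: "nat \<Rightarrow> 'x measure" and p0 :: "nat \<Rightarrow> 'x \<Rightarrow> real"
    and \<epsilon> M L :: real
  assumes n: "n \<ge> 1"
    and sf: "\<And>i. i \<in> {1..n} \<Longrightarrow> sigma_finite_measure (\<mu> i)"
    and p0: "\<And>i. i \<in> {1..n} \<Longrightarrow> prob_density (\<mu> i) (p0 i)"
    and u: "\<And>j i. j \<in> {1..N} \<Longrightarrow> i \<in> {1..n} \<Longrightarrow> integrable (\<mu> i) (u j i)"
      "\<And>j i. j \<in> {1..N} \<Longrightarrow> i \<in> {1..n} \<Longrightarrow> \<forall>x\<in>space (\<mu> i). 0 \<le> u j i x"
    and k: "k \<in> {1..N}" "\<And>i. i \<in> {1..n} \<Longrightarrow> \<forall>x\<in>space (\<mu> i). p0 i x \<le> u k i x"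
      "(\<Sum>i\<in>{1..n}. (hellinger (\<mu> i) (p0 i) (u k i))\<^sup>2) \<le> real n * \<epsilon>\<^sup>2"
    and L: "L > 0"
  defines "post \<equiv> posterior n (uniform_prior N (\<lambda>j. renormalize \<mu> (u j)))
                {f. (avg_hellinger n \<mu> p0 f)\<^sup>2 \<ge> M * \<epsilon>\<^sup>2}"
  shows "(\<integral>x. post x \<partial>joint_distribution n \<mu> p0)
    \<le> real N * (L * exp (- M * (real n * \<epsilon>\<^sup>2) / 2) + exp (16 * (real n * \<epsilon>\<^sup>2)) / L\<^sup>2)"
    and "0 \<le> (\<integral>x. post x \<partial>joint_distribution n \<mu> p0)"
proof -
  define q where "q j = renormalize \<mu> (u j)" for j
  define P where "P = PiM {1..n} \<mu>"
  define J where "J = {j \<in> {1..N}. (avg_hellinger n \<mu> p0 (q j))\<^sup>2 \<ge> M * \<epsilon>\<^sup>2}"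
  define A where "A = exp (- M * (real n * \<epsilon>\<^sup>2) / 2)"
  define B where "B = exp (16 * (real n * \<epsilon>\<^sup>2))"
  define p' where "p' = joint_density n p0"
  define q' where "q' j = joint_density n (q j)" for j
  have N: "N \<ge> 1" using k by simp
  have JN: "J \<subseteq> {1..N}" and finJ: "finite J" by (auto simp: J_def)
  have p0i: "integrable (\<mu> i) (p0 i)" and p00: "\<forall>x\<in>space (\<mu> i). 0 \<le> p0 i x"
    and p01: "(\<integral>x. p0 i x \<partial>\<mu> i) = 1" if "i \<in> {1..n}" for i
    using p0[OF that] by (auto simp: prob_density_def)
  have qi: "integrable (\<mu> i) (q j i)" and q0: "\<forall>x\<in>space (\<mu> i). 0 \<le> q j i x"
    and q1: "(\<integral>x. q j i x \<partial>\<mu> i) \<le> 1" if "j \<in> {1..N}" "i \<in> {1..n}" for i j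
    unfolding q_def using subprob_density_renormalize[where \<mu> = \<mu> and f = "u j" and i = i, OF u[OF that]] by auto
  have [measurable]: "p' \<in> borel_measurable P"
    unfolding p'_def P_def using p0i by (intro measurable_joint_density) auto
  have q'_meas [measurable]: "q' j \<in> borel_measurable P" if "j \<in> {1..N}" for j
    unfolding q'_def P_def using qi[OF that] by (intro measurable_joint_density) auto
  have p'0: "0 \<le> p' x" if "x \<in> space P" for x
    using joint_density_nonneg[of n \<mu> p0 x] p00 that unfolding p'_def P_def by auto
  have q'0: "0 \<le> q' j x" if "j \<in> {1..N}" "x \<in> space P" for j x
    using joint_density_nonneg[of n \<mu> "q j" x] q0 that unfolding q'_def P_def by auto
  have post: "post x = (\<Sum>j\<in>J. q' j x) / (\<Sum>j\<in>{1..N}. q' j x)" for x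
    unfolding post_def posterior_uniform_prior[OF N] J_def q'_def q_def by simp
  have post0: "0 \<le> post x" if "x \<in> space P" for x
    unfolding post using q'0 that JN by (intro divide_nonneg_nonneg sum_nonneg) auto
  have dist: "joint_distribution n \<mu> p0 = density P (\<lambda>x. ennreal (p' x))"
    by (simp add: joint_distribution_def P_def p'_def)
  have post0_AE: "AE x in joint_distribution n \<mu> p0. 0 \<le> post x"
    unfolding dist by (intro AE_I2) (simp add: post0)
  then show "0 \<le> (\<integral>x. post x \<partial>joint_distribution n \<mu> p0)" by (rule integral_nonneg_AE)

  \<comment> \<open>Positivity of \<open>p'\<close> forces every factor of the bracket
    \<open>k\<close> above it to be positive, and its factors have mass at least 1. Hence the
    denominator of the posterior is positive wherever the true density is.\<close>
  have q'k: "0 < q' k x" if "x \<in> space P" "0 < p' x" for x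
    unfolding q'_def joint_density_def
  proof (intro prod_pos)
    fix i assume i: "i \<in> {1..n}"
    have xi: "x i \<in> space (\<mu> i)" using that(1) i by (auto simp: P_def space_PiM PiE_iff)
    have "p0 i (x i) \<noteq> 0"
      using that(2) i prod_zero[of "{1..n}" "\<lambda>i. p0 i (x i)"]
      unfolding p'_def joint_density_def by (metis finite_atLeastAtMost less_irrefl)
    then have "0 < u k i (x i)" using xi p00[OF i] k(2)[OF i] by force
    moreover have "1 \<le> (\<integral>y. u k i y \<partial>\<mu> i)"
      unfolding p01[OF i, symmetric] using k i by (intro integral_mono p0i u) auto
    ultimately show "0 < q k i (x i)" by (simp add: q_def renormalize_def)
  qed
  \<comment> \<open>The denominator dominates both the term \<open>q' j x\<close> itself and the
    term \<open>q' k x\<close>, so each summand is at most 1 and at most their ratio.\<close>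
  have post_le: "post x \<le> (\<Sum>j\<in>J. L * sqrt (q' j x / p' x) + p' x / q' k x / L\<^sup>2)"
    if x: "x \<in> space P" "0 < p' x" for x
  proof -
    define D where "D = (\<Sum>j\<in>{1..N}. q' j x)"
    have D: "q' j x \<le> D" if "j \<in> {1..N}" for j
      unfolding D_def using q'0 x that by (intro member_le_sum) auto
    have D0: "0 < D" using D[OF k(1)] q'k[OF x] by linarith
    have "post x = (\<Sum>j\<in>J. q' j x / D)" by (simp add: post D_def sum_divide_distrib)
    also have "\<dots> \<le> (\<Sum>j\<in>J. L * sqrt (q' j x / p' x) + p' x / q' k x / L\<^sup>2)"
    proof (intro sum_mono)
      fix j assume "j \<in> J"
      then have j: "j \<in> {1..N}" using JN by auto
      have "q' j x / D \<le> q' j x / q' k x"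
        using D[OF k(1)] q'k[OF x] q'0[OF j x(1)] by (intro divide_left_mono) auto
      moreover have "q' j x / D \<le> 1" using D[OF j] D0 by simp
      ultimately have "q' j x / D \<le> min 1 (q' j x / q' k x)" by simp
      also have "\<dots> \<le> L * sqrt (q' j x / p' x) + p' x / q' k x / L\<^sup>2"
        using x q'k[OF x] q'0[OF j x(1)] L by (intro min_one_ratio_le) auto
      finally show "q' j x / D \<le> L * sqrt (q' j x / p' x) + p' x / q' k x / L\<^sup>2" .
    qed
    finally show ?thesis .
  qed

  \<comment> \<open>The affinity factorizes, and for \<open>j\<close> in \<open>J\<close> the
    squared distances add up to at least \<open>M\<close> times
    \<open>real n * \<epsilon>\<^sup>2\<close>.\<close>
  have aff: "(\<integral>\<^sup>+x. ennreal (sqrt (p' x * q' j x)) \<partial>P) \<le> ennreal A" if "j \<in> J" for j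
  proof -
    have j: "j \<in> {1..N}" using that JN by auto
    have eq: "sqrt (p' x * q' j x) = (\<Prod>i\<in>{1..n}. sqrt (p0 i (x i) * q j i (x i)))" for x
      by (simp add: p'_def q'_def joint_density_def real_sqrt_mult sqrt_prod prod.distrib)
    have "(\<integral>\<^sup>+x. ennreal (sqrt (p' x * q' j x)) \<partial>P)
        \<le> ennreal (exp (\<Sum>i\<in>{1..n}. - (hellinger (\<mu> i) (p0 i) (q j i))\<^sup>2 / 2))"
      unfolding eq P_def
    proof (rule nn_integral_PiM_prod_real_le)
      fix i assume i: "i \<in> {1..n}"
      note h = p0i[OF i] p00[OF i] qi[OF j i] q0[OF j i]
      show "integrable (\<mu> i) (\<lambda>y. sqrt (p0 i y * q j i y))" by (rule integrable_sqrt_mult[OF h])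
      show "(\<integral>y. sqrt (p0 i y * q j i y) \<partial>\<mu> i) \<le> exp (- (hellinger (\<mu> i) (p0 i) (q j i))\<^sup>2 / 2)"
        using p01[OF i] q1[OF j i] by (intro affinity_le_exp_hellinger[OF h]) auto
      show "\<forall>y\<in>space (\<mu> i). 0 \<le> sqrt (p0 i y * q j i y)" using h by simp
    qed (auto intro: sf)
    also have "(\<Sum>i\<in>{1..n}. - (hellinger (\<mu> i) (p0 i) (q j i))\<^sup>2 / 2)
        = - (real n * (avg_hellinger n \<mu> p0 (q j))\<^sup>2) / 2"
      by (simp add: avg_hellinger_power2[OF n] sum_negf sum_divide_distrib)
    also have "exp \<dots> \<le> A"
    proof -
      have "real n * (M * \<epsilon>\<^sup>2) \<le> real n * (avg_hellinger n \<mu> p0 (q j))\<^sup>2"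
        using that by (intro mult_left_mono) (auto simp: J_def)
      then show ?thesis by (simp add: A_def mult_ac)
    qed
    finally show ?thesis by (simp add: ennreal_leI)
  qed

  have chi: "(\<integral>\<^sup>+x. ennreal (p' x * (p' x / q' k x)) \<partial>P) \<le> ennreal B"
  proof -
    \<comment> \<open>Undoing the renormalization releases the bracket mass as a factor in each
      coordinate, exactly the form of \<open>bracket_chi_square\<close>.\<close>
    have eq: "p' x * (p' x / q' k x)
        = (\<Prod>i\<in>{1..n}. (\<integral>y. u k i y \<partial>\<mu> i) * ((p0 i (x i))\<^sup>2 / u k i (x i)))" for x
      by (simp add: p'_def q'_def q_def renormalize_def joint_density_def power2_eq_square
          prod_dividef prod.distrib)
    have "(\<integral>\<^sup>+x. ennreal (p' x * (p' x / q' k x)) \<partial>P)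
        \<le> ennreal (exp (\<Sum>i\<in>{1..n}. 16 * (hellinger (\<mu> i) (p0 i) (u k i))\<^sup>2))"
      unfolding eq P_def
    proof (rule nn_integral_PiM_prod_real_le)
      fix i assume i: "i \<in> {1..n}"
      note h = p0[OF i] u(1)[OF k(1) i] k(2)[OF i]
      show "integrable (\<mu> i) (\<lambda>y. (\<integral>y. u k i y \<partial>\<mu> i) * ((p0 i y)\<^sup>2 / u k i y))"
        by (intro integrable_mult_right integrable_square_div_bracket[OF h])
      show "(\<integral>y. (\<integral>y. u k i y \<partial>\<mu> i) * ((p0 i y)\<^sup>2 / u k i y) \<partial>\<mu> i)
          \<le> exp (16 * (hellinger (\<mu> i) (p0 i) (u k i))\<^sup>2)"
        unfolding integral_mult_right_zero by (rule bracket_chi_square[OF h])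
      have "0 \<le> (\<integral>y. u k i y \<partial>\<mu> i)" using u(2)[OF k(1) i] by (intro Bochner_Integration.integral_nonneg) auto
      then show "\<forall>y\<in>space (\<mu> i). 0 \<le> (\<integral>y. u k i y \<partial>\<mu> i) * ((p0 i y)\<^sup>2 / u k i y)"
        using u(2)[OF k(1) i] by simp
    qed (auto intro: sf)
    also have "exp (\<Sum>i\<in>{1..n}. 16 * (hellinger (\<mu> i) (p0 i) (u k i))\<^sup>2) \<le> B"
      using k(3) by (simp add: B_def sum_distrib_left[symmetric])
    finally show ?thesis by (simp add: ennreal_leI)
  qed

  have "(\<integral>\<^sup>+x. ennreal (post x) \<partial>joint_distribution n \<mu> p0)
      \<le> (\<integral>\<^sup>+x. ennreal (\<Sum>j\<in>J. L * sqrt (q' j x / p' x) + p' x / q' k x / L\<^sup>2)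
            \<partial>joint_distribution n \<mu> p0)"
    \<comment> \<open>Almost everywhere under the density means only where \<open>p'\<close> is
      positive, as \<open>post_le\<close> requires.\<close>
    unfolding dist using post_le
    by (intro nn_integral_mono_AE) (auto simp: AE_density intro!: ennreal_leI AE_I2)
  also have "\<dots> = (\<integral>\<^sup>+x. ennreal (p' x) * ennreal (\<Sum>j\<in>J. L * sqrt (q' j x / p' x) + p' x / q' k x / L\<^sup>2) \<partial>P)"
    unfolding dist
  proof (intro nn_integral_density)
    have "(\<lambda>x. L * sqrt (q' j x / p' x) + p' x / q' k x / L\<^sup>2) \<in> borel_measurable P" if "j \<in> J" for j
    proof -
      have [measurable]: "q' j \<in> borel_measurable P" "q' k \<in> borel_measurable P"
        using q'_meas k(1) that JN by auto
      show ?thesis by measurable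
    qed
    then show "(\<lambda>x. ennreal (\<Sum>j\<in>J. L * sqrt (q' j x / p' x) + p' x / q' k x / L\<^sup>2)) \<in> borel_measurable P"
      by (intro measurable_compose[OF _ measurable_ennreal] borel_measurable_sum) auto
  qed simp
  also have "\<dots> \<le> (\<integral>\<^sup>+x. (\<Sum>j\<in>J. ennreal L * ennreal (sqrt (p' x * q' j x))
        + ennreal (1 / L\<^sup>2) * ennreal (p' x * (p' x / q' k x))) \<partial>P)"
  proof (intro nn_integral_mono)
    fix x assume x: "x \<in> space P"
    \<comment> \<open>This also holds at zeros of \<open>p'\<close>, where both sides are 0.\<close>
    have s: "p' x * sqrt (q' j x / p' x) = sqrt (p' x * q' j x)" for j
    proof -
      have "sqrt (p' x * q' j x) = sqrt ((p' x)\<^sup>2 * (q' j x / p' x))" by (simp add: power2_eq_square)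
      also have "\<dots> = p' x * sqrt (q' j x / p' x)"
        using p'0[OF x] by (simp only: real_sqrt_mult real_sqrt_abs abs_of_nonneg)
      finally show ?thesis by simp
    qed
    have "ennreal (p' x) * ennreal (\<Sum>j\<in>J. L * sqrt (q' j x / p' x) + p' x / q' k x / L\<^sup>2)
      = ennreal (p' x * (\<Sum>j\<in>J. L * sqrt (q' j x / p' x) + p' x / q' k x / L\<^sup>2))"
      using p'0[OF x] by (simp add: ennreal_mult')
    also have "p' x * (\<Sum>j\<in>J. L * sqrt (q' j x / p' x) + p' x / q' k x / L\<^sup>2)
      = (\<Sum>j\<in>J. L * sqrt (p' x * q' j x) + 1 / L\<^sup>2 * (p' x * (p' x / q' k x)))"
      unfolding sum_distrib_left by (intro sum.cong refl) (simp add: s[symmetric] algebra_simps)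
    also have "ennreal \<dots> = (\<Sum>j\<in>J. ennreal (L * sqrt (p' x * q' j x) + 1 / L\<^sup>2 * (p' x * (p' x / q' k x))))"
      using x p'0 q'0 k(1) JN L
      by (intro sum_ennreal[symmetric] add_nonneg_nonneg mult_nonneg_nonneg) auto
    also have "\<dots> = (\<Sum>j\<in>J. ennreal L * ennreal (sqrt (p' x * q' j x))
        + ennreal (1 / L\<^sup>2) * ennreal (p' x * (p' x / q' k x)))"
    proof (intro sum.cong refl)
      fix j assume "j \<in> J"
      then have "0 \<le> q' j x" "0 \<le> q' k x" "0 \<le> p' x" using x p'0 q'0 k(1) JN by auto
      then show "ennreal (L * sqrt (p' x * q' j x) + 1 / L\<^sup>2 * (p' x * (p' x / q' k x)))
        = ennreal L * ennreal (sqrt (p' x * q' j x)) + ennreal (1 / L\<^sup>2) * ennreal (p' x * (p' x / q' k x))"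
        using L by (subst ennreal_plus) (auto simp flip: ennreal_mult)
    qed
    finally show "ennreal (p' x) * ennreal (\<Sum>j\<in>J. L * sqrt (q' j x / p' x) + p' x / q' k x / L\<^sup>2)
      \<le> (\<Sum>j\<in>J. ennreal L * ennreal (sqrt (p' x * q' j x))
        + ennreal (1 / L\<^sup>2) * ennreal (p' x * (p' x / q' k x)))" by simp
  qed
  also have "\<dots> = (\<Sum>j\<in>J. ennreal L * (\<integral>\<^sup>+x. ennreal (sqrt (p' x * q' j x)) \<partial>P)
        + ennreal (1 / L\<^sup>2) * (\<integral>\<^sup>+x. ennreal (p' x * (p' x / q' k x)) \<partial>P))"
  proof -
    have m: "(\<lambda>x. ennreal (sqrt (p' x * q' j x))) \<in> borel_measurable P"
      "(\<lambda>x. ennreal (p' x * (p' x / q' k x))) \<in> borel_measurable P" if "j \<in> J" for j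
    proof -
      have [measurable]: "q' j \<in> borel_measurable P" "q' k \<in> borel_measurable P"
        using q'_meas k(1) that JN by auto
      show "(\<lambda>x. ennreal (sqrt (p' x * q' j x))) \<in> borel_measurable P"
        "(\<lambda>x. ennreal (p' x * (p' x / q' k x))) \<in> borel_measurable P" by measurable
    qed
    show ?thesis using m
      by (subst nn_integral_sum) (auto intro!: sum.cong simp: nn_integral_add nn_integral_cmult)
  qed
  also have "\<dots> \<le> (\<Sum>j\<in>J. ennreal L * ennreal A + ennreal (1 / L\<^sup>2) * ennreal B)"
    using aff chi by (intro sum_mono add_mono mult_left_mono) auto
  also have "\<dots> = (\<Sum>j\<in>J. ennreal (L * A + B / L\<^sup>2))"
    using L by (simp add: A_def B_def flip: ennreal_mult ennreal_plus)
  also have "\<dots> = ennreal (\<Sum>j\<in>J. L * A + B / L\<^sup>2)"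
    using L by (intro sum_ennreal) (simp add: A_def B_def)
  also have "\<dots> \<le> ennreal (\<Sum>j\<in>{1..N}. L * A + B / L\<^sup>2)"
    using L JN by (intro ennreal_leI sum_mono2) (auto simp: A_def B_def)
  also have "(\<Sum>j\<in>{1..N}. L * A + B / L\<^sup>2) = real N * (L * A + B / L\<^sup>2)" by simp
  finally show "(\<integral>x. post x \<partial>joint_distribution n \<mu> p0)
    \<le> real N * (L * exp (- M * (real n * \<epsilon>\<^sup>2) / 2) + exp (16 * (real n * \<epsilon>\<^sup>2)) / L\<^sup>2)"
    unfolding A_def[symmetric] B_def[symmetric]
    using L by (intro integral_le_of_nn_integral_le post0_AE) (auto simp: A_def B_def)
qed

section \<open>Choice of the constants and passage to the limit\<close>

theorem theorem8:
  fixes \<mu> :: "nat \<Rightarrow> nat \<Rightarrow> 'x measure"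
    and p :: "nat \<Rightarrow> 't \<Rightarrow> nat \<Rightarrow> 'x \<Rightarrow> real"
    and \<Theta> :: "'t set" and \<Theta>s :: "nat \<Rightarrow> 't set" and \<theta>\<^sub>0 :: 't
    and \<epsilon> :: "nat \<Rightarrow> real" and N :: "nat \<Rightarrow> nat"
    and u :: "nat \<Rightarrow> nat \<Rightarrow> nat \<Rightarrow> 'x \<Rightarrow> real"
  assumes sigma_finite: "\<And>n i. n \<ge> 1 \<Longrightarrow> i \<in> {1..n} \<Longrightarrow> sigma_finite_measure (\<mu> n i)"
    and densities: "\<And>n \<theta> i. n \<ge> 1 \<Longrightarrow> \<theta> \<in> \<Theta> \<Longrightarrow> i \<in> {1..n} \<Longrightarrow> prob_density (\<mu> n i) (p n \<theta> i)"
    and sieve: "incseq \<Theta>s" "(\<Union>n. \<Theta>s n) = \<Theta>"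
    and true_parameter: "\<theta>\<^sub>0 \<in> \<Theta>"
    and rate: "\<And>n. n \<ge> 1 \<Longrightarrow> \<epsilon> n > 0" "\<epsilon> \<longlonglongrightarrow> 0"
      "filterlim (\<lambda>n. real n * (\<epsilon> n)\<^sup>2) at_top sequentially"
    and bracketing_number: "\<And>n. n \<ge> 1 \<Longrightarrow>
      upper_bracketing_number n (\<mu> n) (p n) (\<epsilon> n) (\<Theta>s n) = enat (N n)"
    and entropy: "\<And>n. n \<ge> 1 \<Longrightarrow> ln (real (N n)) \<le> real n * (\<epsilon> n)\<^sup>2"
    and brackets: "\<And>n. n \<ge> 1 \<Longrightarrow>
      upper_bracketing n (\<mu> n) (p n) (\<epsilon> n) (\<Theta>s n) (N n) (u n)"
  shows "\<forall>\<^sub>F M in at_top.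
    (\<lambda>n. \<integral>x. posterior n (uniform_prior (N n) (\<lambda>j. renormalize (\<mu> n) (u n j)))
                {f. (avg_hellinger n (\<mu> n) (p n \<theta>\<^sub>0) f)\<^sup>2 \<ge> M * (\<epsilon> n)\<^sup>2} x
           \<partial>joint_distribution n (\<mu> n) (p n \<theta>\<^sub>0)) \<longlonglongrightarrow> 0"
\<comment> \<open>The final exponents are \<open>1 - M / 4\<close> and \<open>17 - M / 2\<close>
  times \<open>t n\<close>; 40 is a convenient threshold making both coefficients at most
  -1.\<close>
proof (rule eventually_mono[OF eventually_ge_at_top[of 40]])
  fix M :: real assume M: "40 \<le> M"
  define I where "I n = (\<integral>x. posterior n (uniform_prior (N n) (\<lambda>j. renormalize (\<mu> n) (u n j)))
                {f. (avg_hellinger n (\<mu> n) (p n \<theta>\<^sub>0) f)\<^sup>2 \<ge> M * (\<epsilon> n)\<^sup>2} x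
           \<partial>joint_distribution n (\<mu> n) (p n \<theta>\<^sub>0))" for n
  define t where "t n = real n * (\<epsilon> n)\<^sup>2" for n
  \<comment> \<open>A bracket above the true density is available only once the sieve contains
    \<open>\<theta>\<^sub>0\<close>, which holds from \<open>n0\<close> on by monotonicity.\<close>
  obtain n0 where n0: "\<theta>\<^sub>0 \<in> \<Theta>s n0" using true_parameter sieve(2) by auto
  have bounds: "0 \<le> I n \<and> I n \<le> 2 * exp (- t n)" if n: "n \<ge> max 1 n0" for n
  proof -
    have n1: "n \<ge> 1" using n by simp
    have "\<theta>\<^sub>0 \<in> \<Theta>s n" using n0 n incseqD[OF sieve(1), of n0 n] by auto
    then obtain k where k: "k \<in> {1..N n}"
      "\<And>i. i \<in> {1..n} \<Longrightarrow> \<forall>x\<in>space (\<mu> n i). p n \<theta>\<^sub>0 i x \<le> u n k i x"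
      "(\<Sum>i\<in>{1..n}. (hellinger (\<mu> n i) (p n \<theta>\<^sub>0 i) (u n k i))\<^sup>2) \<le> real n * (\<epsilon> n)\<^sup>2"
      using brackets[OF n1] unfolding upper_bracketing_def by blast
    have u: "integrable (\<mu> n i) (u n j i)" "\<forall>x\<in>space (\<mu> n i). 0 \<le> u n j i x"
      if "j \<in> {1..N n}" "i \<in> {1..n}" for i j
      using brackets[OF n1] that unfolding upper_bracketing_def by auto
    have t0: "0 \<le> t n" by (simp add: t_def)
    \<comment> \<open>This spends half of the affinity exponent \<open>M * t n / 2\<close>; the
      square of \<open>L\<close> in the denominator then contributes \<open>- M * t n / 2\<close>
      against the chi-square factor \<open>exp (16 * t n)\<close>.\<close>
    define L where "L = exp (M * t n / 4)"
    have "L > 0" by (simp add: L_def)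
    note E = expected_posterior_le[where \<mu> = "\<mu> n" and u = "u n" and M = M,
        OF n1 sigma_finite[OF n1] densities[OF n1 true_parameter] u k this, folded I_def t_def]
    \<comment> \<open>The index \<open>k\<close> witnesses \<open>N n \<ge> 1\<close>, so the
      logarithm in the entropy bound can be inverted.\<close>
    have "real (N n) = exp (ln (real (N n)))" using k(1) by simp
    also have "\<dots> \<le> exp (t n)" using entropy[OF n1] by (simp add: t_def)
    finally have Nt: "real (N n) \<le> exp (t n)" .
    have "I n \<le> real (N n) * (L * exp (- M * t n / 2) + exp (16 * t n) / L\<^sup>2)" using E(1) by simp
    also have "\<dots> \<le> exp (t n) * (L * exp (- M * t n / 2) + exp (16 * t n) / L\<^sup>2)"
      using Nt by (intro mult_right_mono) (auto simp: L_def)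
    also have "\<dots> = exp ((1 - M / 4) * t n) + exp ((17 - M / 2) * t n)"
      unfolding L_def
      by (simp add: exp_double[symmetric] exp_add[symmetric] exp_diff[symmetric] distrib_left
          flip: exp_of_nat_mult) (simp add: algebra_simps)
    also have "\<dots> \<le> exp (- 1 * t n) + exp (- 1 * t n)"
      using M t0 by (intro add_mono iffD2[OF exp_le_cancel_iff] mult_right_mono) auto
    finally show ?thesis using E(2) by simp
  qed
  have "filterlim (\<lambda>n. - t n) at_bot sequentially"
    using rate(3) unfolding t_def filterlim_uminus_at_bot by simp
  then have "(\<lambda>n. 2 * exp (- t n)) \<longlonglongrightarrow> 2 * 0"
    by (intro tendsto_mult tendsto_const filterlim_compose[OF exp_at_bot])
  then have "(\<lambda>n. 2 * exp (- t n)) \<longlonglongrightarrow> 0" by simp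
  from _ _ tendsto_const this have "I \<longlonglongrightarrow> 0"
  proof (rule tendsto_sandwich)
    show "\<forall>\<^sub>F n in sequentially. 0 \<le> I n" "\<forall>\<^sub>F n in sequentially. I n \<le> 2 * exp (- t n)"
      using bounds by (blast intro: eventually_sequentiallyI)+
  qed
  then show "(\<lambda>n. \<integral>x. posterior n (uniform_prior (N n) (\<lambda>j. renormalize (\<mu> n) (u n j)))
                {f. (avg_hellinger n (\<mu> n) (p n \<theta>\<^sub>0) f)\<^sup>2 \<ge> M * (\<epsilon> n)\<^sup>2} x
           \<partial>joint_distribution n (\<mu> n) (p n \<theta>\<^sub>0)) \<longlonglongrightarrow> 0"
    unfolding I_def .
qed

end
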